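(* Let $m\ge1$ be an integer. Then $$\mathcal L({}^m\ell_1;L_1[0,1])=\mathcal L_{\mathrm{as}(2/m;1)}({}^m\ell_1;L_1[0,1]),$$ and $2/m$ is optimal, i.e. if $0<r<2/m$ then $\mathcal L({}^m\ell_1;L_1[0,1])\ne\mathcal L_{\mathrm{as}(r;1)}({}^m\ell_1;L_1[0,1])$.
   Context: All Banach spaces are over a fixed field $\mathbb K\in\{\mathbb R,\mathbb C\}$; $L_1[0,1]$ is taken with respect to Lebesgue measure. $\mathcal L({}^mE;F)$ denotes the space of continuous $m$-linear maps $E\times\cdots\times E\to F$ with the usual operator norm. The weak $1$-norm of a finite family $(x_j)_{j=1}^N$ in a Banach space $E$ is $\|(x_j)_{j=1}^N\|_{w,1}=\sup_{\varphi\in B_{E^*}}\sum_{j=1}^N|\varphi(x_j)|$, where $B_{E^*}$ is the closed unit ball of the dual. For $0<r<\infty$, an operator $T\in\mathcal L({}^mE;F)$ is absolutely $(r;1)$-summing if there is $C\ge0$ such that $$\Bigl(\sum_{j=1}^N\|T(x_j^{(1)},\ldots,x_j^{(m)})\|^r\Bigr)^{1/r}\le C\prod_{q=1}^m\|(x_j^{(q)})_{j=1}^N\|_{w,1}$$ for every $N\in\mathbb N$ and all finite families $(x_j^{(q)})_{j=1}^N\subset E$, $1\le q\le m$. The class of such maps is $\mathcal L_{\mathrm{as}(r;1)}({}^mE;F)$. *)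

theory Defs
  imports "HOL-Analysis.Analysis"
begin

text \<open>
  The spaces \<open>\<ell>\<^sub>1\<close> and \<open>L\<^sub>1[0,1]\<close> are built over a scalar type \<open>'k\<close>, to be instantiated with
  \<^typ>\<open>real\<close> or \<^typ>\<open>complex\<close>. Since the library has type classes for real normed spaces only,
  multiplication by scalars from \<open>'k\<close> is a separate operation on each space, and \<open>'k\<close>-linearity is
  \<^const>\<open>Vector_Spaces.linear\<close> with respect to these operations.
\<close>

section \<open>The space of absolutely summable sequences\<close>

typedef (overloaded) 'k ell1 = "{x :: nat \<Rightarrow> 'k::real_normed_vector. summable (\<lambda>n. norm (x n))}"
  morphisms ell1_nth Abs_ell1
  by (rule exI[of _ "\<lambda>_. 0"]) simp

setup_lifting type_definition_ell1

lemma summable_norm_add: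
  fixes x y :: "nat \<Rightarrow> 'k::real_normed_vector"
  assumes "summable (\<lambda>n. norm (x n))" "summable (\<lambda>n. norm (y n))"
  shows "summable (\<lambda>n. norm (x n + y n))"
  by (rule summable_comparison_test'[OF summable_add[OF assms], of 0])
     (simp add: norm_triangle_ineq)

lemma summable_norm_diff:
  fixes x y :: "nat \<Rightarrow> 'k::real_normed_vector"
  assumes "summable (\<lambda>n. norm (x n))" "summable (\<lambda>n. norm (y n))"
  shows "summable (\<lambda>n. norm (x n - y n))"
  by (rule summable_comparison_test'[OF summable_add[OF assms], of 0])
     (simp add: norm_triangle_ineq4)

instantiation ell1 :: (real_normed_vector) real_normed_vector
begin

lift_definition zero_ell1 :: "'a ell1" is "\<lambda>_. 0" by simp
lift_definition plus_ell1 :: "'a ell1 \<Rightarrow> 'a ell1 \<Rightarrow> 'a ell1" is "\<lambda>x y n. x n + y n"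
  by (rule summable_norm_add)
lift_definition minus_ell1 :: "'a ell1 \<Rightarrow> 'a ell1 \<Rightarrow> 'a ell1" is "\<lambda>x y n. x n - y n"
  by (rule summable_norm_diff)
lift_definition uminus_ell1 :: "'a ell1 \<Rightarrow> 'a ell1" is "\<lambda>x n. - x n" by simp
lift_definition scaleR_ell1 :: "real \<Rightarrow> 'a ell1 \<Rightarrow> 'a ell1" is "\<lambda>c x n. c *\<^sub>R x n"
  by (simp add: summable_mult)
lift_definition norm_ell1 :: "'a ell1 \<Rightarrow> real" is "\<lambda>x. \<Sum>n. norm (x n)" .

definition sgn_ell1 :: "'a ell1 \<Rightarrow> 'a ell1" where "sgn_ell1 x = inverse (norm x) *\<^sub>R x"
definition dist_ell1 :: "'a ell1 \<Rightarrow> 'a ell1 \<Rightarrow> real" where "dist_ell1 x y = norm (x - y)"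
definition uniformity_ell1 :: "('a ell1 \<times> 'a ell1) filter"
  where "uniformity_ell1 = (INF e\<in>{0 <..}. principal {(x, y). dist x y < e})"
definition open_ell1 :: "'a ell1 set \<Rightarrow> bool"
  where "open_ell1 S = (\<forall>x\<in>S. \<forall>\<^sub>F (x', y) in uniformity. x' = x \<longrightarrow> y \<in> S)"

instance
proof
  fix x y :: "'a ell1" and a :: real
  show "norm x = 0 \<longleftrightarrow> x = 0"
    by transfer (subst suminf_eq_zero_iff, auto)
  show "norm (x + y) \<le> norm x + norm y"
    by transfer (subst suminf_add, assumption, assumption,
      intro suminf_le norm_triangle_ineq summable_norm_add summable_add)
  show "norm (a *\<^sub>R x) = \<bar>a\<bar> * norm x"
    by transfer (simp add: suminf_mult)
qed (transfer; simp add: sgn_ell1_def dist_ell1_def uniformity_ell1_def open_ell1_def algebra_simps fun_eq_iff)+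

end

lift_definition ell1_scale :: "'k::real_normed_field \<Rightarrow> 'k ell1 \<Rightarrow> 'k ell1" is "\<lambda>c x n. c * x n"
  by (simp add: norm_mult summable_mult)

lemma vector_space_ell1_scale: "vector_space ell1_scale"
  by unfold_locales (transfer; simp add: algebra_simps fun_eq_iff)+

lemma norm_ell1_scale: "norm (ell1_scale c x) = norm c * norm x"
  by transfer (simp add: norm_mult suminf_mult)

lemma ell1_scale_of_real: "ell1_scale (of_real r) x = r *\<^sub>R x"
  by transfer (simp add: scaleR_conv_of_real)

section \<open>The space of integrable functions on the unit interval\<close>

text \<open>Integrable functions on \<open>[0,1]\<close> modulo equality almost everywhere; a representative is a
  function on the whole real line, of which only the restriction to \<open>[0,1]\<close> matters.\<close>

abbreviation unit_lebesgue :: "real measure" where "unit_lebesgue \<equiv> lebesgue_on {0..1}"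

quotient_type (overloaded) 'k L1 = "real \<Rightarrow> 'k::{banach,second_countable_topology}" / partial:
  "\<lambda>f g. integrable unit_lebesgue f \<and> integrable unit_lebesgue g \<and> (AE t in unit_lebesgue. f t = g t)"
  morphisms rep_L1 abs_L1
proof (rule part_equivpI)
  show "\<exists>f :: real \<Rightarrow> 'k. integrable unit_lebesgue f \<and> integrable unit_lebesgue f
    \<and> (AE t in unit_lebesgue. f t = f t)"
    by (rule exI[of _ "\<lambda>_. 0"]) simp
qed (auto intro!: sympI transpI)

instantiation L1 :: ("{banach,second_countable_topology}") real_normed_vector
begin

lift_definition zero_L1 :: "'a L1" is "\<lambda>_. 0" by simp
lift_definition plus_L1 :: "'a L1 \<Rightarrow> 'a L1 \<Rightarrow> 'a L1" is "\<lambda>f g t. f t + g t" by auto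
lift_definition minus_L1 :: "'a L1 \<Rightarrow> 'a L1 \<Rightarrow> 'a L1" is "\<lambda>f g t. f t - g t" by auto
lift_definition uminus_L1 :: "'a L1 \<Rightarrow> 'a L1" is "\<lambda>f t. - f t" by auto
lift_definition scaleR_L1 :: "real \<Rightarrow> 'a L1 \<Rightarrow> 'a L1" is "\<lambda>c f t. c *\<^sub>R f t" by auto
lift_definition norm_L1 :: "'a L1 \<Rightarrow> real" is "\<lambda>f. integral\<^sup>L unit_lebesgue (\<lambda>t. norm (f t))"
  by (auto intro!: integral_cong_AE)

definition sgn_L1 :: "'a L1 \<Rightarrow> 'a L1" where "sgn_L1 x = inverse (norm x) *\<^sub>R x"
definition dist_L1 :: "'a L1 \<Rightarrow> 'a L1 \<Rightarrow> real" where "dist_L1 x y = norm (x - y)"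
definition uniformity_L1 :: "('a L1 \<times> 'a L1) filter"
  where "uniformity_L1 = (INF e\<in>{0 <..}. principal {(x, y). dist x y < e})"
definition open_L1 :: "'a L1 set \<Rightarrow> bool"
  where "open_L1 S = (\<forall>x\<in>S. \<forall>\<^sub>F (x', y) in uniformity. x' = x \<longrightarrow> y \<in> S)"

instance
proof
  fix x y z :: "'a L1" and a b :: real
  show "norm x = 0 \<longleftrightarrow> x = 0"
    by transfer (subst integral_nonneg_eq_0_iff_AE, auto)
  show "norm (x + y) \<le> norm x + norm y"
  proof transfer
    fix f g :: "real \<Rightarrow> 'a"
    assume "integrable unit_lebesgue f \<and> integrable unit_lebesgue f
        \<and> (AE t in unit_lebesgue. f t = f t)"
      and "integrable unit_lebesgue g \<and> integrable unit_lebesgue g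
        \<and> (AE t in unit_lebesgue. g t = g t)"
    then have fg: "integrable unit_lebesgue f" "integrable unit_lebesgue g" by auto
    have "integral\<^sup>L unit_lebesgue (\<lambda>t. norm (f t + g t))
        \<le> integral\<^sup>L unit_lebesgue (\<lambda>t. norm (f t) + norm (g t))"
      using fg by (intro integral_mono) (auto simp: norm_triangle_ineq)
    with fg show "integral\<^sup>L unit_lebesgue (\<lambda>t. norm (f t + g t))
        \<le> integral\<^sup>L unit_lebesgue (\<lambda>t. norm (f t)) + integral\<^sup>L unit_lebesgue (\<lambda>t. norm (g t))"
      by simp
  qed
  show "norm (a *\<^sub>R x) = \<bar>a\<bar> * norm x" by transfer simp
  show "sgn x = inverse (norm x) *\<^sub>R x" by (rule sgn_L1_def)
  show "dist x y = norm (x - y)" by (rule dist_L1_def)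
qed (rule uniformity_L1_def open_L1_def | (transfer; auto simp: algebra_simps))+

end

lift_definition L1_scale ::
  "'k::{real_normed_field,banach,second_countable_topology} \<Rightarrow> 'k L1 \<Rightarrow> 'k L1" is "\<lambda>c f t. c * f t"
  by auto

lemma vector_space_L1_scale: "vector_space L1_scale"
  by unfold_locales (transfer; auto simp: algebra_simps)+

lemma norm_L1_scale: "norm (L1_scale c x) = norm c * norm x"
  by transfer (simp add: norm_mult)

lemma L1_scale_of_real: "L1_scale (of_real r) x = r *\<^sub>R x"
  by transfer (auto simp: scaleR_conv_of_real)

section \<open>Multilinear and absolutely summing operators\<close>

text \<open>In this section \<open>s\<close>, \<open>s1\<close>, \<open>s2\<close> are the multiplications by scalars from \<open>'k\<close> on the respective
  spaces; they are meant to satisfy \<open>norm (s c x) = norm c * norm x\<close> and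
  \<open>s (of_real r) x = r *\<^sub>R x\<close>.\<close>

definition dual_unit_ball ::
  "('k::real_normed_field \<Rightarrow> 'e::real_normed_vector \<Rightarrow> 'e) \<Rightarrow> ('e \<Rightarrow> 'k) set" where
  "dual_unit_ball s =
    {\<phi>. Vector_Spaces.linear s (*) \<phi> \<and> bounded_linear \<phi> \<and> onorm \<phi> \<le> 1}"

definition weak_1_norm ::
  "('k::real_normed_field \<Rightarrow> 'e::real_normed_vector \<Rightarrow> 'e) \<Rightarrow> nat \<Rightarrow> (nat \<Rightarrow> 'e) \<Rightarrow> real" where
  "weak_1_norm s N x = (SUP \<phi>\<in>dual_unit_ball s. \<Sum>j<N. norm (\<phi> (x j)))"

text \<open>The supremum is one of real numbers, so it has to be known to be finite.\<close>

lemma zero_in_dual_unit_ball: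
  assumes "vector_space s" shows "(\<lambda>_. 0) \<in> dual_unit_ball s"
proof -
  have "vector_space ((*) :: 'a \<Rightarrow> 'a \<Rightarrow> 'a)" by unfold_locales (simp_all add: algebra_simps)
  moreover have "onorm (\<lambda>_::'b. 0::'a) \<le> 1" by (simp add: onorm_zero)
  ultimately show ?thesis
    using assms by (simp add: dual_unit_ball_def Vector_Spaces.linear_iff)
qed

lemma bdd_above_weak_1_norm:
  "bdd_above ((\<lambda>\<phi>. \<Sum>j<N. norm (\<phi> (x j))) ` dual_unit_ball s)"
proof (rule bdd_aboveI2)
  fix \<phi> assume "\<phi> \<in> dual_unit_ball s"
  then have \<phi>: "bounded_linear \<phi>" "onorm \<phi> \<le> 1" by (auto simp: dual_unit_ball_def)
  have "norm (\<phi> v) \<le> norm v" for v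
    using onorm[OF \<phi>(1), of v] mult_right_mono[OF \<phi>(2) norm_ge_zero[of v]] by simp
  then show "(\<Sum>j<N. norm (\<phi> (x j))) \<le> (\<Sum>j<N. norm (x j))" by (intro sum_mono)
qed

text \<open>An \<open>m\<close>-tuple in \<open>E\<close> is a vector of type \<open>'e ^ 'm\<close> with \<open>m = CARD('m)\<close>; such vectors carry the
  product topology.\<close>

definition multilinear_ops ::
  "('k::real_normed_field \<Rightarrow> 'e::real_normed_vector \<Rightarrow> 'e) \<Rightarrow> ('k \<Rightarrow> 'f::real_normed_vector \<Rightarrow> 'f)
    \<Rightarrow> ('e ^ 'm \<Rightarrow> 'f) set" where
  "multilinear_ops s1 s2 =
    {T. (\<forall>q x. Vector_Spaces.linear s1 s2 (\<lambda>v. T (\<chi> i. if i = q then v else x $ i))) \<and>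
        continuous_on UNIV T}"

definition abs_summing_ops ::
  "real \<Rightarrow> ('k::real_normed_field \<Rightarrow> 'e::real_normed_vector \<Rightarrow> 'e) \<Rightarrow>
    ('k \<Rightarrow> 'f::real_normed_vector \<Rightarrow> 'f) \<Rightarrow> ('e ^ 'm \<Rightarrow> 'f) set" where
  "abs_summing_ops r s1 s2 =
    {T \<in> multilinear_ops s1 s2. \<exists>C\<ge>0. \<forall>N. \<forall>x :: 'm \<Rightarrow> nat \<Rightarrow> 'e.
       (\<Sum>j<N. norm (T (\<chi> q. x q j)) powr r) powr (1 / r) \<le> C * (\<Prod>q\<in>UNIV. weak_1_norm s1 N (x q))}"

end

theory Submission
  imports Defs
begin

text \<open>
  The space \<open>\<ell>\<^sub>1\<close> has cotype 2: by Khinchine's inequality applied in every coordinate, the square sum of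
  the norms of a family in \<open>\<ell>\<^sub>1\<close> is dominated by the average norm of its signed sums, hence by its weak
  1-norm. Since \<open>\<parallel>T (x\<^sub>1, \<dots>, x\<^sub>m)\<parallel> \<le> \<parallel>T\<parallel> \<parallel>x\<^sub>1\<parallel> \<cdots> \<parallel>x\<^sub>m\<parallel>\<close>, Hoelder's inequality with \<open>m\<close> factors turns this
  into \<open>(2/m;1)\<close>-summability.

  The exponent is attained by the tensor map \<open>\<ell>\<^sub>1 \<times> \<cdots> \<times> \<ell>\<^sub>1 \<rightarrow> \<ell>\<^sub>1(\<nat>\<^sup>m) \<cong> \<ell>\<^sub>1 \<rightarrow> L\<^sub>1[0,1]\<close>, for which the norm
  of the value is the product of the norms. The first \<open>N\<close> Rademacher functions, as normalised elements
  of \<open>\<ell>\<^sub>1\<close> on \<open>2\<^sup>N\<close> points, have weak 1-norm at most \<open>\<surd>N\<close>, so \<open>(r;1)\<close>-summability would give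
  \<open>N\<^sup>1\<^sup>/\<^sup>r \<le> C N\<^sup>m\<^sup>/\<^sup>2\<close> for all \<open>N\<close>.
\<close>

section \<open>Khinchine's inequality\<close>

text \<open>The sign is read off binary digit \<open>j\<close> of \<open>n\<close>. As
  \<open>n\<close> runs below \<open>2 ^ N\<close>, the first \<open>N\<close> signs run through
  every pattern exactly once, so sums over \<open>n < 2 ^ N\<close> are averages over independent
  signs.\<close>

definition rademacher :: "nat \<Rightarrow> nat \<Rightarrow> real" where
  "rademacher j n = (-1) ^ (n div 2 ^ j)"

lemma abs_rademacher [simp]: "\<bar>rademacher j n\<bar> = 1"
  by (simp add: rademacher_def power_abs)

lemma rademacher_0: "rademacher 0 (2 * n) = 1" "rademacher 0 (2 * n + 1) = -1"
  by (simp_all add: rademacher_def)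

lemma rademacher_Suc:
  "rademacher (Suc j) (2 * n) = rademacher j n" "rademacher (Suc j) (2 * n + 1) = rademacher j n"
  by (simp_all add: rademacher_def div_mult2_eq)

lemma sum_lessThan_double:
  "(\<Sum>n<2 * K. f n) = (\<Sum>n<K. f (2 * n) + f (2 * n + 1 :: nat) :: 'a::comm_monoid_add)"
  by (induction K) (simp_all add: add.assoc)

text \<open>The last binary digit of \<open>n\<close> is split off: it carries the sign of
  \<open>a 0\<close>, and the other digits serve the shifted family. This drives the inductions for
  both moments.\<close>

lemma sum_rademacher_Suc:
  fixes g :: "'a::real_vector \<Rightarrow> 'b::comm_monoid_add"
  shows "(\<Sum>n<2 ^ Suc N. g (\<Sum>j<Suc N. rademacher j n *\<^sub>R a j))
    = (\<Sum>n<2 ^ N. g ((\<Sum>j<N. rademacher j n *\<^sub>R a (Suc j)) + a 0)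
                + g ((\<Sum>j<N. rademacher j n *\<^sub>R a (Suc j)) - a 0))"
  by (simp only: power_Suc sum_lessThan_double sum.lessThan_Suc_shift rademacher_0 rademacher_Suc)
     (simp add: add.commute)

text \<open>Pairing the two signs of \<open>a 0\<close> removes the cross terms by the parallelogram
  law. Real inner products cover real and complex scalars alike.\<close>

lemma rademacher_moment2:
  fixes a :: "nat \<Rightarrow> 'a::real_inner"
  shows "(\<Sum>n<2 ^ N. (norm (\<Sum>j<N. rademacher j n *\<^sub>R a j))\<^sup>2) = 2 ^ N * (\<Sum>j<N. (norm (a j))\<^sup>2)"
proof (induction N arbitrary: a)
  case (Suc N)
  have parallelogram: "(norm (s + b))\<^sup>2 + (norm (s - b))\<^sup>2 = 2 * (norm s)\<^sup>2 + 2 * (norm b)\<^sup>2" for s b :: 'a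
    by (simp add: power2_norm_eq_inner inner_simps)
  show ?case
    unfolding sum_rademacher_Suc[of "\<lambda>s. (norm s)\<^sup>2"] parallelogram sum.distrib
      sum_distrib_left[symmetric] Suc.IH[of "\<lambda>j. a (Suc j)"]
    by (simp add: sum.lessThan_Suc_shift algebra_simps del: sum.lessThan_Suc)
qed simp

lemma rademacher_moment4:
  fixes a :: "nat \<Rightarrow> 'a::real_inner"
  shows "(\<Sum>n<2 ^ N. (norm (\<Sum>j<N. rademacher j n *\<^sub>R a j)) ^ 4)
    \<le> 2 ^ N * 3 * (\<Sum>j<N. (norm (a j))\<^sup>2)\<^sup>2"
proof (induction N arbitrary: a)
  case (Suc N)
  have step: "(norm (s + b)) ^ 4 + (norm (s - b)) ^ 4
      \<le> 2 * (norm s) ^ 4 + 12 * (norm b)\<^sup>2 * (norm s)\<^sup>2 + 2 * (norm b) ^ 4" for s b :: 'a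
  proof -
    \<comment> \<open>The coefficient 12 arises as 4 from squaring the sum of squares plus 8 from
      this Cauchy-Schwarz bound.\<close>
    have *: "(s \<bullet> b)\<^sup>2 \<le> (norm s)\<^sup>2 * (norm b)\<^sup>2"
      using Cauchy_Schwarz_ineq[of s b] by (simp add: power2_norm_eq_inner)
    have "(norm (s + b)) ^ 4 + (norm (s - b)) ^ 4
        = ((norm (s + b))\<^sup>2)\<^sup>2 + ((norm (s - b))\<^sup>2)\<^sup>2"
      by simp
    also have "\<dots> = ((norm s)\<^sup>2 + (norm b)\<^sup>2 + 2 * (s \<bullet> b))\<^sup>2 + ((norm s)\<^sup>2 + (norm b)\<^sup>2 - 2 * (s \<bullet> b))\<^sup>2"
      by (simp add: power2_norm_eq_inner inner_simps inner_commute algebra_simps)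
    also have "\<dots> = 2 * ((norm s)\<^sup>2 + (norm b)\<^sup>2)\<^sup>2 + 8 * (s \<bullet> b)\<^sup>2"
      by (simp add: power2_eq_square algebra_simps)
    also have "\<dots> \<le> 2 * ((norm s)\<^sup>2 + (norm b)\<^sup>2)\<^sup>2 + 8 * ((norm s)\<^sup>2 * (norm b)\<^sup>2)"
      using * by simp
    also have "\<dots> = 2 * (norm s) ^ 4 + 12 * (norm b)\<^sup>2 * (norm s)\<^sup>2 + 2 * (norm b) ^ 4"
      by (simp add: power2_eq_square power4_eq_xxxx algebra_simps)
    finally show ?thesis .
  qed
  define V where "V = (\<Sum>j<N. (norm (a (Suc j)))\<^sup>2)"
  define u where "u = (norm (a 0))\<^sup>2"
  define S where "S n = (\<Sum>j<N. rademacher j n *\<^sub>R a (Suc j))" for n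
  have "(\<Sum>n<2 ^ Suc N. (norm (\<Sum>j<Suc N. rademacher j n *\<^sub>R a j)) ^ 4)
      = (\<Sum>n<2 ^ N. (norm (S n + a 0)) ^ 4 + (norm (S n - a 0)) ^ 4)"
    unfolding sum_rademacher_Suc[of "\<lambda>s. (norm s) ^ 4"] S_def ..
  also have "\<dots> \<le> (\<Sum>n<2 ^ N. 2 * (norm (S n)) ^ 4 + 12 * u * (norm (S n))\<^sup>2 + 2 * u\<^sup>2)"
    using step[of "S _" "a 0"] by (intro sum_mono) (simp add: u_def)
  also have "\<dots> = 2 * (\<Sum>n<2 ^ N. (norm (S n)) ^ 4) + 12 * u * (2 ^ N * V) + 2 ^ N * (2 * u\<^sup>2)"
    by (simp add: sum.distrib sum_distrib_left[symmetric] S_def V_def rademacher_moment2)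
  \<comment> \<open>Enlarging \<open>2 * u\<^sup>2\<close> to \<open>6 * u\<^sup>2\<close> completes
    the square; the constant 3 then reproduces itself.\<close>
  also have "\<dots> \<le> 2 * (2 ^ N * 3 * V\<^sup>2) + 12 * u * (2 ^ N * V) + 2 ^ N * (6 * u\<^sup>2)"
    using Suc.IH[of "\<lambda>j. a (Suc j)"] by (intro add_mono mult_left_mono) (auto simp: S_def V_def u_def)
  also have "\<dots> = 2 ^ Suc N * 3 * (u + V)\<^sup>2"
    by (simp add: power2_eq_square algebra_simps)
  also have "u + V = (\<Sum>j<Suc N. (norm (a j))\<^sup>2)"
    by (simp add: sum.lessThan_Suc_shift u_def V_def del: sum.lessThan_Suc)
  finally show ?case .
qed simp

text \<open>Averaging \<open>2 t \<ge> 3 t\<^sup>2 - t\<^sup>4\<close> at \<open>t = |S| / (2 \<sigma>)\<close> reduces the first moment to the second and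
  the fourth one.\<close>

lemma khinchine:
  fixes a :: "nat \<Rightarrow> 'a::real_inner"
  shows "2 ^ N * L2_set (\<lambda>j. norm (a j)) {..<N}
    \<le> 2 * (\<Sum>n<2 ^ N. norm (\<Sum>j<N. rademacher j n *\<^sub>R a j))"
proof -
  define \<sigma> where "\<sigma> = L2_set (\<lambda>j. norm (a j)) {..<N}"
  define S where "S n = norm (\<Sum>j<N. rademacher j n *\<^sub>R a j)" for n
  have \<sigma>2: "\<sigma>\<^sup>2 = (\<Sum>j<N. (norm (a j))\<^sup>2)"
    by (simp add: \<sigma>_def L2_set_def sum_nonneg)
  show ?thesis
  proof (cases "\<sigma> = 0")
    case True
    then show ?thesis by (simp add: \<sigma>_def sum_nonneg)
  next
    case False
    then have pos: "\<sigma> > 0" by (simp add: \<sigma>_def order_less_le)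
    have ineq: "16 * \<sigma> ^ 3 * s \<ge> 12 * \<sigma>\<^sup>2 * s\<^sup>2 - s ^ 4" if "s \<ge> 0" for s :: real
    proof -
      have "16 * \<sigma> ^ 3 * s - 12 * \<sigma>\<^sup>2 * s\<^sup>2 + s ^ 4 = s * ((s - 2 * \<sigma>)\<^sup>2 * (s + 4 * \<sigma>))"
        by (simp add: power2_eq_square power3_eq_cube power4_eq_xxxx algebra_simps)
      also have "\<dots> \<ge> 0" using that pos by simp
      finally show ?thesis by simp
    qed
    \<comment> \<open>Here 9 = 12 - 3, with 3 from the fourth moment. The resulting constant 16/9 is
      finally rounded up to 2.\<close>
    have "9 * 2 ^ N * \<sigma> ^ 4 = 12 * \<sigma>\<^sup>2 * (2 ^ N * \<sigma>\<^sup>2) - 2 ^ N * 3 * (\<sigma>\<^sup>2)\<^sup>2"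
      by (simp add: power2_eq_square power4_eq_xxxx)
    also have "\<dots> \<le> 12 * \<sigma>\<^sup>2 * (\<Sum>n<2 ^ N. (S n)\<^sup>2) - (\<Sum>n<2 ^ N. (S n) ^ 4)"
      unfolding S_def \<sigma>2 rademacher_moment2 using rademacher_moment4[of a N] by simp
    also have "\<dots> = (\<Sum>n<2 ^ N. 12 * \<sigma>\<^sup>2 * (S n)\<^sup>2 - (S n) ^ 4)"
      by (simp add: sum_subtractf sum_distrib_left)
    also have "\<dots> \<le> (\<Sum>n<2 ^ N. 16 * \<sigma> ^ 3 * S n)"
      by (intro sum_mono ineq) (simp add: S_def)
    also have "\<dots> = \<sigma> ^ 3 * (16 * (\<Sum>n<2 ^ N. S n))"
      by (simp add: sum_distrib_left mult_ac)
    finally have "\<sigma> ^ 3 * (9 * (2 ^ N * \<sigma>)) \<le> \<sigma> ^ 3 * (16 * (\<Sum>n<2 ^ N. S n))"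
      by (simp add: power3_eq_cube power4_eq_xxxx mult_ac)
    then have "9 * (2 ^ N * \<sigma>) \<le> 16 * (\<Sum>n<2 ^ N. S n)"
      using pos by simp
    moreover have "0 \<le> (\<Sum>n<2 ^ N. S n)" by (simp add: S_def sum_nonneg)
    ultimately show ?thesis unfolding \<sigma>_def[symmetric] S_def[symmetric] by linarith
  qed
qed

section \<open>Weak norms in \<open>\<ell>\<^sub>1\<close>\<close>

lemma summable_ell1_nth: "summable (\<lambda>n. norm (ell1_nth x n))"
  using ell1_nth[of x] by simp

lemma ell1_nth_sum: "ell1_nth (\<Sum>j\<in>A. f j) i = (\<Sum>j\<in>A. ell1_nth (f j) i)"
  by (induction A rule: infinite_finite_induct) (simp_all add: zero_ell1.rep_eq plus_ell1.rep_eq)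

lemma vector_space_mult: "vector_space ((*) :: 'k \<Rightarrow> 'k \<Rightarrow> 'k::field)"
  by unfold_locales (simp_all add: algebra_simps)

text \<open>Pairing with the bounded sequence of conjugate phases of \<open>z\<close> gives the
  functional explicitly, without Hahn-Banach.\<close>

lemma ell1_norming_functional:
  fixes z :: "'k::{real_normed_field,banach} ell1"
  obtains \<phi> where "\<phi> \<in> dual_unit_ball ell1_scale" "\<phi> z = of_real (norm z)"
proof -
  \<comment> \<open>Division by zero yields 0, so vanishing coordinates of \<open>z\<close> need no
    case distinction.\<close>
  define c where "c i = of_real (norm (ell1_nth z i)) / ell1_nth z i" for i
  have c: "norm (c i) \<le> 1" for i by (simp add: c_def norm_divide)
  define \<phi> where "\<phi> v = (\<Sum>i. c i * ell1_nth v i)" for v :: "'k ell1"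
  have norm_summable: "summable (\<lambda>i. norm (c i * ell1_nth v i))" for v
    by (rule summable_comparison_test'[OF summable_ell1_nth[of v], of 0])
       (simp add: norm_mult c mult_left_le_one_le)
  have summable: "summable (\<lambda>i. c i * ell1_nth v i)" for v
    using norm_summable by (rule summable_norm_cancel)
  have add: "\<phi> (v + w) = \<phi> v + \<phi> w" for v w
    by (simp add: \<phi>_def plus_ell1.rep_eq distrib_left suminf_add[OF summable summable])
  have scale: "\<phi> (ell1_scale k v) = k * \<phi> v" for k v
    using suminf_mult[OF summable[of v], of k] by (simp add: \<phi>_def ell1_scale.rep_eq mult_ac)
  have bound: "norm (\<phi> v) \<le> norm v" for v
  proof -
    have "norm (\<phi> v) \<le> (\<Sum>i. norm (c i * ell1_nth v i))"
      unfolding \<phi>_def by (rule summable_norm[OF norm_summable])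
    also have "\<dots> \<le> (\<Sum>i. norm (ell1_nth v i))"
      by (intro suminf_le norm_summable summable_ell1_nth)
         (simp add: norm_mult c mult_left_le_one_le)
    finally show ?thesis by (simp add: norm_ell1.rep_eq)
  qed
  have "\<phi> \<in> dual_unit_ball ell1_scale"
    unfolding dual_unit_ball_def Vector_Spaces.linear_iff mem_Collect_eq
  proof (intro conjI allI)
    show "bounded_linear \<phi>"
      using add scale[of "of_real _"] bound
      by (intro bounded_linear_intro[of _ 1]) (simp_all add: ell1_scale_of_real scaleR_conv_of_real)
    show "onorm \<phi> \<le> 1" using bound by (intro onorm_bound) simp_all
  qed (simp_all add: add scale vector_space_ell1_scale vector_space_mult)
  moreover have "\<phi> z = of_real (norm z)"
    unfolding \<phi>_def norm_ell1.rep_eq suminf_of_real[OF summable_ell1_nth]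
    by (rule suminf_cong) (simp add: c_def)
  ultimately show thesis using that by blast
qed

text \<open>The norming functional of the signed sum competes in the supremum. The choice
  \<open>\<epsilon> = 0\<close> yields nonnegativity of the weak norm.\<close>

lemma norm_signed_sum_le_weak_1_norm:
  fixes x :: "nat \<Rightarrow> 'k::{real_normed_field,banach} ell1"
  assumes "\<And>j. \<bar>\<epsilon> j\<bar> \<le> 1"
  shows "norm (\<Sum>j<N. \<epsilon> j *\<^sub>R x j) \<le> weak_1_norm ell1_scale N x"
proof -
  obtain \<phi> where \<phi>: "\<phi> \<in> dual_unit_ball ell1_scale"
    "\<phi> (\<Sum>j<N. \<epsilon> j *\<^sub>R x j) = of_real (norm (\<Sum>j<N. \<epsilon> j *\<^sub>R x j))"
    by (rule ell1_norming_functional)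
  interpret bounded_linear \<phi> using \<phi>(1) by (simp add: dual_unit_ball_def)
  have "norm (\<Sum>j<N. \<epsilon> j *\<^sub>R x j) = norm (\<Sum>j<N. \<epsilon> j *\<^sub>R \<phi> (x j))"
    using arg_cong[OF \<phi>(2), of norm] by (simp add: sum scaleR)
  also have "\<dots> \<le> (\<Sum>j<N. norm (\<phi> (x j)))"
    by (rule sum_norm_le) (simp add: assms mult_left_le_one_le)
  also have "\<dots> \<le> weak_1_norm ell1_scale N x"
    unfolding weak_1_norm_def by (rule cSUP_upper[OF \<phi>(1) bdd_above_weak_1_norm])
  finally show ?thesis .
qed

text \<open>This is the statement that the identity of \<open>\<ell>\<^sub>1\<close> is \<open>(2;1)\<close>-summing.\<close>

lemma orlicz_ell1:
  fixes x :: "nat \<Rightarrow> 'k::{real_normed_field,euclidean_space} ell1"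
  shows "L2_set (\<lambda>j. norm (x j)) {..<N} \<le> 2 * weak_1_norm ell1_scale N x"
proof -
  define \<sigma> where "\<sigma> = L2_set (\<lambda>j. norm (x j)) {..<N}"
  define w where "w = weak_1_norm ell1_scale N x"
  define S where "S n = (\<Sum>j<N. rademacher j n *\<^sub>R x j)" for n
  have \<sigma>: "\<sigma> \<ge> 0" by (simp add: \<sigma>_def)
  have S_nth: "ell1_nth (S n) i = (\<Sum>j<N. rademacher j n *\<^sub>R ell1_nth (x j) i)" for n i
    by (simp add: S_def ell1_nth_sum scaleR_ell1.rep_eq)
  \<comment> \<open>Cauchy-Schwarz with weights \<open>norm (x j)\<close>, then Khinchine in
    coordinate \<open>i\<close>. These weights make the left side sum over \<open>i\<close> to
    \<open>2 ^ N * \<sigma>\<^sup>2\<close>, so one factor \<open>\<sigma>\<close> can be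
    cancelled.\<close>
  have coord: "2 ^ N * (\<Sum>j<N. norm (x j) * norm (ell1_nth (x j) i))
      \<le> \<sigma> * (2 * (\<Sum>n<2 ^ N. norm (ell1_nth (S n) i)))" for i
  proof -
    have "(\<Sum>j<N. norm (x j) * norm (ell1_nth (x j) i)) \<le> \<sigma> * L2_set (\<lambda>j. norm (ell1_nth (x j) i)) {..<N}"
      using L2_set_mult_ineq[of "\<lambda>j. norm (x j)" "\<lambda>j. norm (ell1_nth (x j) i)" "{..<N}"]
      by (simp add: \<sigma>_def)
    then have "2 ^ N * (\<Sum>j<N. norm (x j) * norm (ell1_nth (x j) i))
        \<le> \<sigma> * (2 ^ N * L2_set (\<lambda>j. norm (ell1_nth (x j) i)) {..<N})"
      by simp
    also have "\<dots> \<le> \<sigma> * (2 * (\<Sum>n<2 ^ N. norm (ell1_nth (S n) i)))"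
      unfolding S_nth by (rule mult_left_mono[OF khinchine \<sigma>])
    finally show ?thesis .
  qed
  have sums: "(\<lambda>i. norm (ell1_nth y i)) sums norm y" for y :: "'k ell1"
    unfolding norm_ell1.rep_eq by (rule summable_sums[OF summable_ell1_nth])
  have "2 ^ N * (\<Sum>j<N. norm (x j) * norm (x j)) \<le> \<sigma> * (2 * (\<Sum>n<2 ^ N. norm (S n)))"
  proof (rule sums_le)
    show "(\<lambda>i. 2 ^ N * (\<Sum>j<N. norm (x j) * norm (ell1_nth (x j) i))) sums
        (2 ^ N * (\<Sum>j<N. norm (x j) * norm (x j)))"
      by (intro sums_mult sums_sum sums)
    show "(\<lambda>i. \<sigma> * (2 * (\<Sum>n<2 ^ N. norm (ell1_nth (S n) i)))) sums
        (\<sigma> * (2 * (\<Sum>n<2 ^ N. norm (S n))))"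
      by (intro sums_mult sums_sum sums)
  qed (rule coord)
  also have "\<dots> \<le> \<sigma> * (2 * (\<Sum>n<(2::nat) ^ N. w))"
    unfolding S_def w_def
    by (intro mult_left_mono sum_mono norm_signed_sum_le_weak_1_norm) (simp_all add: \<sigma>)
  finally have "2 ^ N * (\<sigma> * \<sigma>) \<le> 2 ^ N * (\<sigma> * (2 * w))"
    by (simp add: \<sigma>_def L2_set_def sum_nonneg power2_eq_square mult_ac)
  then have "\<sigma> * \<sigma> \<le> \<sigma> * (2 * w)" by simp
  moreover have "0 \<le> w"
    using norm_signed_sum_le_weak_1_norm[of "\<lambda>_. 0" x N] by (simp add: w_def)
  ultimately show ?thesis
    using \<sigma> unfolding \<sigma>_def[symmetric] w_def[symmetric] by (cases "\<sigma> = 0") auto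
qed

text \<open>Phases \<open>\<theta>\<close> aligned with the values of a functional turn its absolute
  sum into one value at a linear combination. They are taken from the scalar field because real
  signs do not suffice over the complex numbers.\<close>

lemma weak_1_norm_le:
  fixes x :: "nat \<Rightarrow> 'e::real_normed_vector"
  assumes "vector_space s"
    and "\<And>\<theta>. (\<And>j. norm (\<theta> j) \<le> 1) \<Longrightarrow> norm (\<Sum>j<N. s (\<theta> j) (x j)) \<le> B"
  shows "weak_1_norm s N x \<le> B"
  unfolding weak_1_norm_def
proof (rule cSUP_least)
  show "dual_unit_ball s \<noteq> {}" using zero_in_dual_unit_ball[OF assms(1)] by auto
next
  fix \<phi> assume "\<phi> \<in> dual_unit_ball s"
  then have lin: "Vector_Spaces.linear s (*) \<phi>" and bl: "bounded_linear \<phi>" and on: "onorm \<phi> \<le> 1"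
    by (auto simp: dual_unit_ball_def)
  interpret bounded_linear \<phi> by (rule bl)
  define \<theta> where "\<theta> j = of_real (norm (\<phi> (x j))) / \<phi> (x j)" for j
  have "(\<Sum>j<N. norm (\<phi> (x j))) = norm (of_real (\<Sum>j<N. norm (\<phi> (x j))) :: 'a)"
    by (simp only: norm_of_real) (simp add: sum_nonneg)
  also have "of_real (\<Sum>j<N. norm (\<phi> (x j))) = (\<Sum>j<N. \<theta> j * \<phi> (x j))"
    unfolding of_real_sum by (rule sum.cong) (auto simp: \<theta>_def)
  also have "\<dots> = \<phi> (\<Sum>j<N. s (\<theta> j) (x j))"
    using lin by (simp add: sum Vector_Spaces.linear_iff)
  also have "norm \<dots> \<le> onorm \<phi> * norm (\<Sum>j<N. s (\<theta> j) (x j))" by (rule onorm[OF bl])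
  also have "\<dots> \<le> norm (\<Sum>j<N. s (\<theta> j) (x j))"
    using mult_right_mono[OF on norm_ge_zero] by simp
  also have "\<dots> \<le> B" by (rule assms(2)) (simp add: \<theta>_def norm_divide)
  finally show "(\<Sum>j<N. norm (\<phi> (x j))) \<le> B" .
qed

text \<open>The factor \<open>1 / 2 ^ N\<close> is the mass of a point under the uniform probability
  on \<open>2 ^ N\<close> points.\<close>

lift_definition rademacher_ell1 :: "nat \<Rightarrow> nat \<Rightarrow> 'k::real_normed_field ell1" is
  "\<lambda>N j n. if n < 2 ^ N then of_real (rademacher j n / 2 ^ N) else 0"
  by (rule summable_finite[of "{..<2 ^ _}"]) auto

lemma norm_ell1_finite:
  assumes "\<And>n. n \<ge> M \<Longrightarrow> ell1_nth x n = 0"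
  shows "norm x = (\<Sum>n<M. norm (ell1_nth x n))"
  unfolding norm_ell1.rep_eq using assms by (intro suminf_finite) auto

lemma norm_rademacher_ell1 [simp]: "norm (rademacher_ell1 N j) = 1"
  by (subst norm_ell1_finite[of "2 ^ N"])
     (simp_all add: rademacher_ell1.rep_eq norm_divide norm_power flip: power_mult_distrib)

text \<open>The norm of a combination is the mean of a modulus, hence at most its quadratic mean,
  which \<open>rademacher_moment2\<close> evaluates.\<close>

lemma weak_1_norm_rademacher_ell1_le:
  "weak_1_norm ell1_scale N (rademacher_ell1 N :: nat \<Rightarrow> 'k::{real_normed_field,euclidean_space} ell1) \<le> sqrt N"
proof (rule weak_1_norm_le[OF vector_space_ell1_scale])
  fix \<theta> :: "nat \<Rightarrow> 'k" assume \<theta>: "\<And>j. norm (\<theta> j) \<le> 1"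
  define S where "S n = norm (\<Sum>j<N. rademacher j n *\<^sub>R \<theta> j)" for n
  have nth: "ell1_nth (\<Sum>j<N. ell1_scale (\<theta> j) (rademacher_ell1 N j)) n
      = (if n < 2 ^ N then (\<Sum>j<N. rademacher j n *\<^sub>R \<theta> j) /\<^sub>R 2 ^ N else 0)" for n
    by (simp add: ell1_nth_sum ell1_scale.rep_eq rademacher_ell1.rep_eq scaleR_conv_of_real
        sum_distrib_left divide_inverse mult_ac)
  have "norm (\<Sum>j<N. ell1_scale (\<theta> j) (rademacher_ell1 N j :: 'k ell1)) = (\<Sum>n<2 ^ N. S n / 2 ^ N)"
    by (subst norm_ell1_finite[of "2 ^ N"]) (simp_all add: nth S_def divide_inverse mult.commute)
  also have "\<dots> = (\<Sum>n<2 ^ N. S n) / 2 ^ N" by (simp add: sum_divide_distrib)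
  also have "\<dots> \<le> sqrt N"
  proof -
    have "(\<Sum>n<2 ^ N. S n)\<^sup>2 \<le> (\<Sum>n<2 ^ N. (S n)\<^sup>2) * 2 ^ N"
      using Cauchy_Schwarz_ineq_sum[of S "\<lambda>_. 1" "{..<2 ^ N}"] by simp
    also have "(\<Sum>n<2 ^ N. (S n)\<^sup>2) \<le> 2 ^ N * N"
    proof -
      have "(\<Sum>j<N. (norm (\<theta> j))\<^sup>2) \<le> (\<Sum>j<N. 1)"
        using \<theta> by (intro sum_mono) (simp add: power_le_one)
      then show ?thesis by (simp add: S_def rademacher_moment2)
    qed
    finally have "((\<Sum>n<2 ^ N. S n) / 2 ^ N)\<^sup>2 \<le> N"
      by (simp add: power_divide divide_simps power2_eq_square mult_ac)
    then show ?thesis by (rule real_le_rsqrt)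
  qed
  finally show "norm (\<Sum>j<N. ell1_scale (\<theta> j) (rademacher_ell1 N j :: 'k ell1)) \<le> sqrt N" .
qed

section \<open>Bounded multilinear operators\<close>

text \<open>Continuity is left out, so that the locale serves both for deriving a bound from
  continuity and for the converse.\<close>

locale multilinear =
  fixes s1 :: "'k::real_normed_field \<Rightarrow> 'e::real_normed_vector \<Rightarrow> 'e"
    and s2 :: "'k \<Rightarrow> 'f::real_normed_vector \<Rightarrow> 'f"
    and T :: "'e ^ 'm::finite \<Rightarrow> 'f"
  assumes slot_linear: "Vector_Spaces.linear s1 s2 (\<lambda>v. T (\<chi> i. if i = q then v else x $ i))"
    and s1_of_real: "s1 (of_real r) v = r *\<^sub>R v"
    and s2_of_real: "s2 (of_real r) w = r *\<^sub>R w"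
begin

lemma slot_scaleR:
  "T (\<chi> i. if i = q then r *\<^sub>R v else x $ i) = r *\<^sub>R T (\<chi> i. if i = q then v else x $ i)"
  using slot_linear[of q x] unfolding Vector_Spaces.linear_iff by (metis s1_of_real s2_of_real)

lemma slot_add:
  "T (\<chi> i. if i = q then v + w else x $ i)
    = T (\<chi> i. if i = q then v else x $ i) + T (\<chi> i. if i = q then w else x $ i)"
  using slot_linear[of q x] by (simp add: Vector_Spaces.linear_iff)

lemma eq_0_if_slot_0:
  assumes "x $ q = 0"
  shows "T x = 0"
proof -
  have "x = (\<chi> i. if i = q then 0 *\<^sub>R 0 else x $ i)"
    using assms by (simp add: vec_eq_iff)
  also have "T \<dots> = 0" using slot_scaleR[of q 0 0 x] by (simp only: scaleR_zero_left)
  finally show ?thesis .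
qed

lemma scaleR_slots: "T (\<chi> i. c i *\<^sub>R x $ i) = (\<Prod>i\<in>UNIV. c i) *\<^sub>R T x"
proof -
  have "T (\<chi> i. if i \<in> A then c i *\<^sub>R x $ i else x $ i) = (\<Prod>i\<in>A. c i) *\<^sub>R T x" if "finite A" for A
    using that
  proof (induction A)
    case (insert q A)
    define y where "y = (\<chi> i. if i \<in> A then c i *\<^sub>R x $ i else x $ i)"
    have "(\<chi> i. if i \<in> insert q A then c i *\<^sub>R x $ i else x $ i)
        = (\<chi> i. if i = q then c q *\<^sub>R x $ q else y $ i)"
      by (auto simp: y_def vec_eq_iff)
    also have "T \<dots> = c q *\<^sub>R T (\<chi> i. if i = q then x $ q else y $ i)"
      by (rule slot_scaleR)
    also have "(\<chi> i. if i = q then x $ q else y $ i) = y"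
      using insert.hyps by (auto simp: y_def vec_eq_iff)
    finally show ?case using insert by (simp add: y_def)
  qed simp
  from this[of UNIV] show ?thesis by simp
qed

text \<open>Continuity at 0 gives a ball of radius \<open>d\<close> on which \<open>T\<close> stays
  below 1. Scaling each slot to norm \<open>d / (2 * m)\<close> moves any tuple without zero slots
  into it, and homogeneity undoes the scaling.\<close>

lemma bounded_if_continuous:
  assumes "continuous_on UNIV T"
  obtains K where "K > 0" "\<And>x. norm (T x) \<le> K * (\<Prod>q\<in>UNIV. norm (x $ q))"
proof -
  define m where "m = real CARD('m)"
  have m: "m > 0" by (simp add: m_def)
  have T0: "T 0 = 0" by (rule eq_0_if_slot_0[of _ undefined]) simp
  from assms have "isCont T 0" by (simp add: continuous_on_eq_continuous_at)
  then obtain d where d: "d > 0" "\<And>x. norm x < d \<Longrightarrow> norm (T x) < 1"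
    unfolding continuous_at_eps_delta using T0 by (auto dest: spec[of _ 1])
  define c where "c = d / (2 * m)"
  have c: "c > 0" using d m by (simp add: c_def)
  show thesis
  proof (rule that[of "(1 / c) ^ CARD('m)"])
    fix x :: "'e ^ 'm"
    show "norm (T x) \<le> (1 / c) ^ CARD('m) * (\<Prod>q\<in>UNIV. norm (x $ q))"
    proof (cases "\<exists>q. x $ q = 0")
      case True
      then have "T x = 0" using eq_0_if_slot_0 by blast
      then show ?thesis using c by (simp add: prod_nonneg)
    next
      case False
      define y where "y = (\<chi> q. (c / norm (x $ q)) *\<^sub>R x $ q)"
      have "norm y \<le> (\<Sum>q\<in>UNIV. norm (y $ q))"
        unfolding norm_vec_def by (rule L2_set_le_sum) simp
      also have "\<dots> = m * c" using False c by (simp add: y_def m_def)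
      also have "\<dots> < d" using d m by (simp add: c_def)
      finally have "norm (T y) < 1" by (rule d)
      moreover have "norm (T y) = (\<Prod>q\<in>UNIV. c / norm (x $ q)) * norm (T x)"
        unfolding y_def scaleR_slots using c by (simp add: abs_prod)
      moreover have "(\<Prod>q\<in>UNIV. c / norm (x $ q)) = c ^ CARD('m) / (\<Prod>q\<in>UNIV. norm (x $ q))"
        by (simp add: prod_dividef)
      moreover have "(\<Prod>q\<in>UNIV. norm (x $ q)) > 0"
        using False by (intro prod_pos) simp
      ultimately show ?thesis using c by (simp add: field_simps)
    qed
  qed (use c in simp)
qed

text \<open>Telescoping: the slots of \<open>x\<close> are exchanged for those of \<open>y\<close>
  one at a time. Each exchange adds a value of \<open>T\<close> with \<open>y $ q - x $ q\<close> in
  slot \<open>q\<close>, which the bound sends to 0.\<close>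

lemma continuous_if_bounded:
  assumes bound: "\<And>x. norm (T x) \<le> K * (\<Prod>q\<in>UNIV. norm (x $ q))"
  shows "continuous_on UNIV T"
proof -
  have "isCont T x" for x
  proof -
    have "((\<lambda>y. T (\<chi> i. if i \<in> A then y $ i else x $ i)) \<longlongrightarrow> T x) (at x)" if "finite A" for A
      using that
    proof (induction A)
      case (insert q A)
      define z where "z y = (\<chi> i. if i \<in> A then y $ i else x $ i)" for y
      define z' where "z' y = (\<chi> i. if i = q then y $ q - x $ q else z y $ i)" for y
      have split: "T (\<chi> i. if i \<in> insert q A then y $ i else x $ i) = T (z' y) + T (z y)" for y
      proof -
        have "(\<chi> i. if i \<in> insert q A then y $ i else x $ i)
            = (\<chi> i. if i = q then (y $ q - x $ q) + x $ q else z y $ i)"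
          by (auto simp: z_def vec_eq_iff)
        moreover have "(\<chi> i. if i = q then x $ q else z y $ i) = z y"
          using insert.hyps by (auto simp: z_def vec_eq_iff)
        ultimately show ?thesis using slot_add[of q "y $ q - x $ q" "x $ q" "z y"] by (simp add: z'_def)
      qed
      have coord: "((\<lambda>y. z' y $ i) \<longlongrightarrow> z' x $ i) (at x)" for i
        using LIM_zero[OF tendsto_vec_nth[OF tendsto_ident_at[of x UNIV], of q]]
          tendsto_vec_nth[OF tendsto_ident_at[of x UNIV], of i]
        by (cases "i = q"; cases "i \<in> A") (simp_all add: z'_def z_def)
      have "((\<lambda>y. K * (\<Prod>i\<in>UNIV. norm (z' y $ i))) \<longlongrightarrow> K * (\<Prod>i\<in>UNIV. norm (z' x $ i))) (at x)"
        by (intro tendsto_intros coord)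
      also have "K * (\<Prod>i\<in>UNIV. norm (z' x $ i)) = 0"
        by (simp add: z'_def prod_zero_iff) (metis norm_zero)
      finally have "((\<lambda>y. T (z' y)) \<longlongrightarrow> 0) (at x)"
        by (rule Lim_null_comparison[rotated]) (simp add: bound)
      then have "((\<lambda>y. T (z' y) + T (z y)) \<longlongrightarrow> 0 + T x) (at x)"
        using insert.IH by (intro tendsto_add) (simp_all add: z_def)
      then show ?case by (simp only: split add_0_left)
    qed simp
    from this[of UNIV] show ?thesis by (simp add: isCont_def)
  qed
  then show ?thesis by (simp add: continuous_at_imp_continuous_on)
qed

end

lemma multilinear_ell1_L1:
  fixes T :: "'k::{real_normed_field,banach,second_countable_topology} ell1 ^ 'm::finite \<Rightarrow> 'k L1"
  assumes "T \<in> multilinear_ops ell1_scale L1_scale"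
  shows "multilinear ell1_scale L1_scale T"
  using assms by (intro multilinear.intro) (auto simp: multilinear_ops_def ell1_scale_of_real L1_scale_of_real)

section \<open>Summability of multilinear operators\<close>

text \<open>Normalised Hoelder inequality with equal exponents, from the arithmetic-geometric mean
  inequality applied for each \<open>j\<close>.\<close>

lemma holder_geometric_mean:
  fixes a :: "'m::finite \<Rightarrow> nat \<Rightarrow> real"
  assumes nonneg: "\<And>q j. a q j \<ge> 0" and le1: "\<And>q. (\<Sum>j<N. a q j) \<le> 1"
  shows "(\<Sum>j<N. (\<Prod>q\<in>UNIV. a q j) powr (1 / CARD('m))) \<le> 1"
proof -
  have "(\<Sum>j<N. (\<Prod>q\<in>UNIV. a q j) powr (1 / CARD('m))) \<le> (\<Sum>j<N. \<Sum>q\<in>UNIV. a q j / CARD('m))"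
    by (intro sum_mono arith_geom_mean) (simp_all add: nonneg)
  also have "\<dots> = (\<Sum>q\<in>UNIV. (\<Sum>j<N. a q j) / CARD('m))"
    by (subst sum.swap) (simp add: sum_divide_distrib)
  also have "\<dots> \<le> (\<Sum>q\<in>(UNIV :: 'm set). 1 / CARD('m))"
    by (intro sum_mono divide_right_mono le1) simp
  finally show ?thesis by simp
qed

lemma abs_summing_if_bounded:
  fixes T :: "'k::{real_normed_field,euclidean_space} ell1 ^ 'm::finite \<Rightarrow> 'f::real_normed_vector"
  assumes "K > 0" and bound: "\<And>x. norm (T x) \<le> K * (\<Prod>q\<in>UNIV. norm (x $ q))"
  shows "(\<Sum>j<N. norm (T (\<chi> q. x q j)) powr (2 / CARD('m))) powr (1 / (2 / CARD('m)))
    \<le> K * 2 ^ CARD('m) * (\<Prod>q\<in>UNIV. weak_1_norm ell1_scale N (x q))"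
proof -
  define p where "p = 2 / real CARD('m)"
  have p: "p > 0" by (simp add: p_def)
  define w where "w q = 2 * weak_1_norm ell1_scale N (x q)" for q
  have L2: "L2_set (\<lambda>j. norm (x q j)) {..<N} \<le> w q" for q
    unfolding w_def by (rule orlicz_ell1)
  have w0: "w q \<ge> 0" for q
    using L2[of q] L2_set_nonneg[of "\<lambda>j. norm (x q j)" "{..<N}"] by linarith
  have K_w: "K * 2 ^ CARD('m) * (\<Prod>q\<in>UNIV. weak_1_norm ell1_scale N (x q)) = K * (\<Prod>q\<in>UNIV. w q)"
    by (simp add: w_def prod.distrib)
  define W where "W = K * (\<Prod>q\<in>UNIV. w q)"
  have W0: "W \<ge> 0" using assms(1) w0 by (simp add: W_def prod_nonneg)
  have "(\<Sum>j<N. norm (T (\<chi> q. x q j)) powr p) \<le> W powr p"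
  \<comment> \<open>If some \<open>w q\<close> is 0, normalising is impossible, but the whole family
    in that slot vanishes and so does the left side.\<close>
  proof (cases "\<exists>q. w q = 0")
    case True
    then obtain q where "w q = 0" ..
    then have "L2_set (\<lambda>j. norm (x q j)) {..<N} = 0"
      using L2[of q] L2_set_nonneg[of "\<lambda>j. norm (x q j)" "{..<N}"] by linarith
    then have x0: "x q j = 0" if "j < N" for j using that by (simp add: L2_set_eq_0_iff)
    have "norm (T (\<chi> q. x q j)) = 0" if "j < N" for j
    proof -
      have "(\<Prod>i\<in>UNIV. norm ((\<chi> q. x q j) $ i)) = 0"
        using x0[OF that] by (intro prod_zero) auto
      with bound[of "\<chi> q. x q j"] show ?thesis by (simp del: vec_lambda_beta)
    qed
    then show ?thesis by simp
  next
    case False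
    then have wpos: "w q > 0" for q using w0[of q] by (metis order_le_less)
    \<comment> \<open>Squares, because \<open>orlicz_ell1\<close> bounds their sum by 1 and the
      power \<open>2 / CARD('m)\<close> of a product is the geometric mean of the squared
      factors.\<close>
    define a where "a q j = (norm (x q j) / w q)\<^sup>2" for q j
    have "norm (T (\<chi> q. x q j)) powr p \<le> W powr p * (\<Prod>q\<in>UNIV. a q j) powr (1 / CARD('m))" for j
    proof -
      have "norm (T (\<chi> q. x q j)) \<le> K * (\<Prod>q\<in>UNIV. norm (x q j))"
        using bound[of "\<chi> q. x q j"] by simp
      also have "\<dots> = W * (\<Prod>q\<in>UNIV. norm (x q j) / w q)"
        using wpos by (simp add: W_def prod_dividef less_imp_neq[symmetric])
      finally have "norm (T (\<chi> q. x q j)) powr p \<le> (W * (\<Prod>q\<in>UNIV. norm (x q j) / w q)) powr p"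
        using p by (intro powr_mono2) simp_all
      also have "\<dots> = W powr p * (\<Prod>q\<in>UNIV. norm (x q j) / w q) powr p"
        by (rule powr_mult)
      also have "(\<Prod>q\<in>UNIV. norm (x q j) / w q) powr p = (\<Prod>q\<in>UNIV. a q j) powr (1 / CARD('m))"
      proof -
        define P where "P = (\<Prod>q\<in>UNIV. norm (x q j) / w q)"
        have "P \<ge> 0" using w0 by (simp add: P_def prod_nonneg)
        moreover have "(\<Prod>q\<in>UNIV. a q j) = P\<^sup>2" by (simp add: a_def P_def prod_power_distrib)
        ultimately show ?thesis
          by (cases "P = 0") (simp_all add: p_def powr_powr flip: P_def powr_numeral)
      qed
      finally show ?thesis .
    qed
    then have "(\<Sum>j<N. norm (T (\<chi> q. x q j)) powr p)
        \<le> W powr p * (\<Sum>j<N. (\<Prod>q\<in>UNIV. a q j) powr (1 / CARD('m)))"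
      unfolding sum_distrib_left by (intro sum_mono)
    also have "\<dots> \<le> W powr p * 1"
    proof (intro mult_left_mono holder_geometric_mean)
      fix q
      have "(\<Sum>j<N. a q j) = (L2_set (\<lambda>j. norm (x q j)) {..<N} / w q)\<^sup>2"
        by (simp add: a_def L2_set_def power_divide sum_divide_distrib sum_nonneg)
      also have "\<dots> \<le> 1"
        using L2[of q] wpos[of q] by (intro power_le_one) simp_all
      finally show "(\<Sum>j<N. a q j) \<le> 1" .
    qed (simp_all add: a_def)
    finally show ?thesis by simp
  qed
  then have "(\<Sum>j<N. norm (T (\<chi> q. x q j)) powr p) powr (1 / p) \<le> (W powr p) powr (1 / p)"
    using p by (intro powr_mono2 sum_nonneg) simp_all
  also have "\<dots> = W" using p W0 by (simp add: powr_powr)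
  finally show ?thesis unfolding K_w p_def W_def .
qed

lemma multilinear_ops_eq_abs_summing_ops:
  "(multilinear_ops ell1_scale L1_scale
      :: ('k::{real_normed_field,euclidean_space} ell1 ^ 'm::finite \<Rightarrow> 'k L1) set)
    = abs_summing_ops (2 / real CARD('m)) ell1_scale L1_scale"
proof (intro equalityI subsetI)
  fix T :: "'k ell1 ^ 'm \<Rightarrow> 'k L1"
  assume T: "T \<in> multilinear_ops ell1_scale L1_scale"
  interpret multilinear ell1_scale L1_scale T using T by (rule multilinear_ell1_L1)
  obtain K where "K > 0" "\<And>x. norm (T x) \<le> K * (\<Prod>q\<in>UNIV. norm (x $ q))"
    using T bounded_if_continuous by (auto simp: multilinear_ops_def)
  from abs_summing_if_bounded[OF this] \<open>K > 0\<close> T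
  show "T \<in> abs_summing_ops (2 / real CARD('m)) ell1_scale L1_scale"
    unfolding abs_summing_ops_def mem_Collect_eq
    by (intro conjI exI[of _ "K * 2 ^ CARD('m)"]) auto
qed (simp add: abs_summing_ops_def)

section \<open>An isometric embedding of \<open>\<ell>\<^sub>1\<close> into \<open>L\<^sub>1[0,1]\<close>\<close>

definition cell :: "nat \<Rightarrow> real set" where
  "cell n = {(1 / 2) ^ Suc n<..(1 / 2) ^ n}"

lemma cell_subset: "cell n \<subseteq> {0..1}"
proof
  fix t assume "t \<in> cell n"
  then have "(1 / 2) ^ Suc n < t" "t \<le> (1 / 2) ^ n" by (simp_all add: cell_def)
  moreover have "(0::real) < (1 / 2) ^ Suc n" "(1 / 2 :: real) ^ n \<le> 1"
    by (simp_all add: power_le_one)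
  ultimately show "t \<in> {0..1}" by simp
qed

lemma cell_disjoint:
  assumes "t \<in> cell m" "t \<in> cell n"
  shows "m = n"
proof -
  have "\<not> k < l" if "t \<in> cell k" "t \<in> cell l" for k l
  proof
    assume "k < l"
    then have "(1 / 2 :: real) ^ l \<le> (1 / 2) ^ Suc k" by (intro power_decreasing) auto
    with that show False by (simp add: cell_def)
  qed
  with assms show ?thesis by (meson linorder_neqE_nat)
qed

lemma measurable_cell: "cell n \<in> sets unit_lebesgue"
  using cell_subset[of n] by (simp add: sets_restrict_space_iff cell_def)

lemma measure_cell: "measure unit_lebesgue (cell n) = (1 / 2) ^ Suc n"
proof -
  have "measure unit_lebesgue (cell n) = measure lebesgue (cell n)"
    using cell_subset[of n] by (intro measure_restrict_space) auto
  then show ?thesis by (simp add: cell_def field_simps)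
qed

lemma has_bochner_integral_cell:
  "has_bochner_integral unit_lebesgue (\<lambda>t. indicator (cell n) t *\<^sub>R (2 ^ Suc n *\<^sub>R (c :: 'b::{banach,second_countable_topology}))) c"
proof -
  have "emeasure unit_lebesgue (cell n) < \<infinity>"
    using cell_subset[of n] by (subst emeasure_restrict_space) (auto simp: cell_def)
  from has_bochner_integral_indicator[OF measurable_cell this, of "2 ^ Suc n *\<^sub>R c"]
  show ?thesis by (simp add: measure_cell flip: power_mult_distrib)
qed

text \<open>\<open>2 ^ Suc n\<close> is the reciprocal of the length of \<open>cell n\<close>, so
  term \<open>n\<close> has integral \<open>x n\<close>. At each point at most one term is
  nonzero.\<close>

definition step_function :: "(nat \<Rightarrow> 'b::real_normed_vector) \<Rightarrow> real \<Rightarrow> 'b" where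
  "step_function x t = (\<Sum>n. indicator (cell n) t *\<^sub>R (2 ^ Suc n *\<^sub>R x n))"

lemma step_function_in_cell:
  assumes "t \<in> cell k"
  shows "step_function x t = 2 ^ Suc k *\<^sub>R x k"
  unfolding step_function_def using assms
  by (subst suminf_finite[of "{k}"]) (auto simp: indicator_def dest: cell_disjoint)

lemma step_function_outside_cells: "(\<And>k. t \<notin> cell k) \<Longrightarrow> step_function x t = 0"
  by (simp add: step_function_def)

lemma step_function_add: "step_function (\<lambda>n. x n + y n) t = step_function x t + step_function y t"
  by (cases "\<exists>k. t \<in> cell k")
    (auto simp: step_function_in_cell step_function_outside_cells algebra_simps)

lemma step_function_mult:
  "step_function (\<lambda>n. c * x n :: 'b::real_normed_algebra) t = c * step_function x t"
  by (cases "\<exists>k. t \<in> cell k") (auto simp: step_function_in_cell step_function_outside_cells)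

lemma norm_step_function: "norm (step_function x t) = step_function (\<lambda>n. norm (x n)) t"
  by (cases "\<exists>k. t \<in> cell k") (auto simp: step_function_in_cell step_function_outside_cells)

text \<open>Termwise integration is allowed since the terms have integrated norms
  \<open>norm (x n)\<close>. Applied to the sequence of norms, it gives the isometry.\<close>

lemma has_bochner_integral_step_function:
  fixes x :: "nat \<Rightarrow> 'b::{banach,second_countable_topology}"
  assumes "summable (\<lambda>n. norm (x n))"
  shows "has_bochner_integral unit_lebesgue (step_function x) (\<Sum>n. x n)"
proof -
  define f where "f n t = indicator (cell n) t *\<^sub>R (2 ^ Suc n *\<^sub>R x n)" for n t
  have f: "has_bochner_integral unit_lebesgue (f n) (x n)" for n
    unfolding f_def by (rule has_bochner_integral_cell)
  have norm_f: "(LINT t|unit_lebesgue. norm (f n t)) = norm (x n)" for n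
    using has_bochner_integral_cell[of n "norm (x n)"]
    by (simp add: f_def has_bochner_integral_iff abs_mult mult_ac)
  have "summable (\<lambda>n. norm (f n t))" for t
  proof (cases "\<exists>k. t \<in> cell k")
    case True
    then obtain k where "t \<in> cell k" ..
    then show ?thesis
      by (intro summable_finite[of "{k}"]) (auto simp: f_def indicator_def dest: cell_disjoint)
  qed (simp add: f_def)
  then have AE: "AE t in unit_lebesgue. summable (\<lambda>n. norm (f n t))" by simp
  have int: "integrable unit_lebesgue (f n)" for n using f by (simp add: has_bochner_integral_iff)
  have sum: "summable (\<lambda>n. LINT t|unit_lebesgue. norm (f n t))"
    using assms by (simp add: norm_f)
  have eq: "step_function x = (\<lambda>t. \<Sum>n. f n t)"
    by (simp add: fun_eq_iff step_function_def f_def)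
  show ?thesis
    using integrable_suminf[OF int AE sum] integral_suminf[OF int AE sum] f
    by (simp add: eq has_bochner_integral_iff)
qed

lift_definition ell1_to_L1 :: "'k::{banach,second_countable_topology} ell1 \<Rightarrow> 'k L1" is step_function
  using has_bochner_integral_step_function by (auto simp: has_bochner_integral_iff)

lemma ell1_to_L1_add: "ell1_to_L1 (x + y) = ell1_to_L1 x + ell1_to_L1 y"
  by transfer
    (auto simp: step_function_add has_bochner_integral_step_function[THEN has_bochner_integral_iff[THEN iffD1]]
      summable_norm_add)

lemma ell1_to_L1_scale: "ell1_to_L1 (ell1_scale c x) = L1_scale c (ell1_to_L1 x)"
  by transfer
    (auto simp: step_function_mult has_bochner_integral_step_function[THEN has_bochner_integral_iff[THEN iffD1]]
      norm_mult summable_mult)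

lemma norm_ell1_to_L1: "norm (ell1_to_L1 x) = norm x"
proof transfer
  fix x :: "nat \<Rightarrow> 'a"
  assume "summable (\<lambda>n. norm (x n))"
  then show "(LINT t|unit_lebesgue. norm (step_function x t)) = (\<Sum>n. norm (x n))"
    using has_bochner_integral_step_function[of "\<lambda>n. norm (x n)"]
    by (simp add: norm_step_function has_bochner_integral_iff)
qed

section \<open>The tensor product map\<close>

text \<open>An arbitrary enumeration of the multi-indices, identifying summable families on them
  with elements of \<open>ell1\<close>.\<close>

definition multi_index :: "nat \<Rightarrow> 'm::finite \<Rightarrow> nat" where
  "multi_index = from_nat_into UNIV"

lemma bij_multi_index: "bij (multi_index :: nat \<Rightarrow> 'm::finite \<Rightarrow> nat)"
proof -
  have "infinite (UNIV :: ('m \<Rightarrow> nat) set)"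
    using finite_fun_UNIVD2 infinite_UNIV_nat by blast
  then show ?thesis unfolding multi_index_def by (intro bij_betw_from_nat_into) auto
qed

text \<open>A product of nonnegative series expands over all multi-indices, and unconditional
  summability permits any enumeration.\<close>

lemma sums_prod_multi_index:
  fixes f :: "'m::finite \<Rightarrow> nat \<Rightarrow> real"
  assumes nonneg: "\<And>q k. f q k \<ge> 0" and summable: "\<And>q. summable (f q)"
  shows "(\<lambda>n. \<Prod>q\<in>UNIV. f q (multi_index n q)) sums (\<Prod>q\<in>UNIV. suminf (f q))"
proof -
  have has_sum: "(f q has_sum suminf (f q)) UNIV" for q
    using summable nonneg by (intro sums_nonneg_imp_has_sum summable_sums)
  define g where "g h = (\<Prod>q\<in>UNIV. f q (h q))" for h :: "'m \<Rightarrow> nat"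
  have "(g has_sum (\<Prod>q\<in>UNIV. suminf (f q))) UNIV"
  \<comment> \<open>A zero value of \<open>infsum\<close> does not certify summability, so this case
    is settled directly.\<close>
  proof (cases "\<exists>q. suminf (f q) = 0")
    case True
    then obtain q where q: "suminf (f q) = 0" ..
    then have "f q k = 0" for k
      using suminf_eq_zero_iff[OF summable nonneg] by blast
    then have "g h = 0" for h unfolding g_def by (intro prod_zero) auto
    moreover have "(\<Prod>q\<in>UNIV. suminf (f q)) = 0" using q by (intro prod_zero) auto
    ultimately show ?thesis by (metis has_sum_0)
  next
    case False
    have "infsum g (PiE UNIV (\<lambda>_. UNIV)) = (\<Prod>q\<in>UNIV. infsum (f q) UNIV)"
      unfolding g_def
    proof (rule infsum_prod_PiE_abs)
      show "(\<lambda>k. norm (f q k)) summable_on UNIV" for q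
        using has_sum[of q] nonneg by (auto simp: summable_on_def)
    qed simp
    then have "infsum g UNIV = (\<Prod>q\<in>UNIV. suminf (f q))"
      using infsumI[OF has_sum] by simp
    \<comment> \<open>\<^const>\<open>infsum\<close> vanishes on families that are not summable.\<close>
    moreover have "(\<Prod>q\<in>UNIV. suminf (f q)) \<noteq> 0" using False by simp
    ultimately show ?thesis by (metis has_sum_infsum infsum_not_exists)
  qed
  then have "((\<lambda>n. g (multi_index n)) has_sum (\<Prod>q\<in>UNIV. suminf (f q))) UNIV"
    using has_sum_reindex_bij_betw[OF bij_multi_index, of g] by simp
  then show ?thesis unfolding g_def by (rule has_sum_imp_sums)
qed

definition ell1_tensor :: "'k::{real_normed_field} ell1 ^ 'm::finite \<Rightarrow> 'k ell1" where
  "ell1_tensor x = Abs_ell1 (\<lambda>n. \<Prod>q\<in>UNIV. ell1_nth (x $ q) (multi_index n q))"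

text \<open>This yields both that the argument of \<open>Abs_ell1\<close> is summable and the norm
  of the tensor.\<close>

lemma sums_norm_ell1_tensor:
  fixes x :: "'k::real_normed_field ell1 ^ 'm::finite"
  shows "(\<lambda>n. norm (\<Prod>q\<in>UNIV. ell1_nth (x $ q) (multi_index n q))) sums (\<Prod>q\<in>UNIV. norm (x $ q))"
  unfolding norm_ell1.rep_eq prod_norm[symmetric]
  by (rule sums_prod_multi_index) (simp_all add: summable_ell1_nth)

lemma ell1_nth_tensor: "ell1_nth (ell1_tensor x) n = (\<Prod>q\<in>UNIV. ell1_nth (x $ q) (multi_index n q))"
  unfolding ell1_tensor_def using sums_norm_ell1_tensor[of x]
  by (subst Abs_ell1_inverse) (auto simp: sums_iff)

lemma norm_ell1_tensor: "norm (ell1_tensor x) = (\<Prod>q\<in>UNIV. norm (x $ q))"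
  using sums_norm_ell1_tensor[of x] unfolding norm_ell1.rep_eq[of "ell1_tensor x"] ell1_nth_tensor
  by (simp add: sums_iff)

lemma ell1_nth_tensor_slot:
  "ell1_nth (ell1_tensor (\<chi> i. if i = q then v else x $ i)) n
    = ell1_nth v (multi_index n q) * (\<Prod>i\<in>UNIV - {q}. ell1_nth (x $ i) (multi_index n i))"
  unfolding ell1_nth_tensor by (subst prod.remove[of _ q]) auto

lemma ell1_tensor_slot_linear:
  "Vector_Spaces.linear ell1_scale ell1_scale (\<lambda>v. ell1_tensor (\<chi> i. if i = q then v else x $ i))"
  by (auto simp: Vector_Spaces.linear_iff vector_space_ell1_scale ell1_nth_inject[symmetric]
      fun_eq_iff ell1_nth_tensor_slot plus_ell1.rep_eq ell1_scale.rep_eq algebra_simps)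

section \<open>Optimality of the exponent\<close>

definition tensor_op ::
  "'k::{real_normed_field,banach,second_countable_topology} ell1 ^ 'm::finite \<Rightarrow> 'k L1" where
  "tensor_op x = ell1_to_L1 (ell1_tensor x)"

lemma norm_tensor_op: "norm (tensor_op x) = (\<Prod>q\<in>UNIV. norm (x $ q))"
  by (simp add: tensor_op_def norm_ell1_to_L1 norm_ell1_tensor)

lemma tensor_op_slot_linear:
  "Vector_Spaces.linear ell1_scale L1_scale (\<lambda>v. tensor_op (\<chi> i. if i = q then v else x $ i))"
  using ell1_tensor_slot_linear[of q x]
  by (simp add: tensor_op_def Vector_Spaces.linear_iff vector_space_L1_scale ell1_to_L1_add ell1_to_L1_scale)

lemma tensor_op_multilinear: "tensor_op \<in> multilinear_ops ell1_scale L1_scale"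
proof -
  interpret multilinear ell1_scale L1_scale tensor_op
    by (intro multilinear.intro tensor_op_slot_linear ell1_scale_of_real L1_scale_of_real)
  have "continuous_on UNIV tensor_op"
    by (rule continuous_if_bounded[of 1]) (simp add: norm_tensor_op)
  then show ?thesis by (simp add: multilinear_ops_def tensor_op_slot_linear)
qed

lemma multilinear_ops_neq_abs_summing_ops:
  assumes r: "0 < r" "r < 2 / real CARD('m)"
  shows "(multilinear_ops ell1_scale L1_scale
      :: ('k::{real_normed_field,euclidean_space} ell1 ^ 'm::finite \<Rightarrow> 'k L1) set)
    \<noteq> abs_summing_ops r ell1_scale L1_scale"
proof
  define m where "m = real CARD('m)"
  have m: "m > 0" by (simp add: m_def)
  assume "(multilinear_ops ell1_scale L1_scale :: ('k ell1 ^ 'm \<Rightarrow> 'k L1) set)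
    = abs_summing_ops r ell1_scale L1_scale"
  then have "(tensor_op :: 'k ell1 ^ 'm \<Rightarrow> 'k L1) \<in> abs_summing_ops r ell1_scale L1_scale"
    using tensor_op_multilinear by blast
  then obtain C where "C \<ge> 0" and C: "\<And>N (x :: 'm \<Rightarrow> nat \<Rightarrow> 'k ell1).
      (\<Sum>j<N. norm (tensor_op (\<chi> q. x q j)) powr r) powr (1 / r)
        \<le> C * (\<Prod>q\<in>UNIV. weak_1_norm ell1_scale N (x q))"
    by (auto simp: abs_summing_ops_def)
  have bound: "real N powr (1 / r) \<le> C * real N powr (m / 2)" for N
  proof -
    \<comment> \<open>The same family fills every slot; all values of \<open>tensor_op\<close> on it
      have norm 1, so the left side is \<open>N powr (1 / r)\<close>.\<close>
    let ?x = "\<lambda>_::'m. rademacher_ell1 N :: nat \<Rightarrow> 'k ell1"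
    have "0 \<le> weak_1_norm ell1_scale N (?x q)" for q :: 'm
      using norm_signed_sum_le_weak_1_norm[of "\<lambda>_. 0" "?x q" N] by simp
    then have "(\<Prod>q\<in>UNIV. weak_1_norm ell1_scale N (?x q)) \<le> (\<Prod>q\<in>(UNIV :: 'm set). sqrt N)"
      by (intro prod_mono) (simp add: weak_1_norm_rademacher_ell1_le)
    also have "\<dots> = real N powr (m / 2)"
      by (cases "N = 0") (simp_all add: m_def powr_powr flip: powr_half_sqrt powr_realpow)
    finally have "C * (\<Prod>q\<in>UNIV. weak_1_norm ell1_scale N (?x q)) \<le> C * real N powr (m / 2)"
      using \<open>C \<ge> 0\<close> by (rule mult_left_mono)
    with C[where N = N and x = ?x] show ?thesis by (simp add: norm_tensor_op)
  qed
  define e where "e = 1 / r - m / 2"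
  have e: "e > 0" using r m by (simp add: e_def m_def field_simps)
  \<comment> \<open>Chosen to force \<open>N powr e\<close> above \<open>C\<close>; the maximum with
    1 keeps \<open>N\<close> positive for the strict multiplication.\<close>
  obtain N where N: "real N > max 1 ((C + 1) powr (1 / e))"
    using reals_Archimedean2 by blast
  have "C < C + 1" by simp
  also have "\<dots> = ((C + 1) powr (1 / e)) powr e"
    using e \<open>C \<ge> 0\<close> by (simp add: powr_powr)
  also have "\<dots> \<le> real N powr e"
    using N e by (intro powr_mono2) auto
  finally have "C * real N powr (m / 2) < real N powr e * real N powr (m / 2)"
    using N by (intro mult_strict_right_mono) auto
  also have "\<dots> = real N powr (1 / r)" by (simp add: e_def flip: powr_add)
  finally show False using bound[of N] by simp
qed

theorem corollary5p3:
  shows "((multilinear_ops ell1_scale L1_scale :: (real ell1 ^ 'm::finite \<Rightarrow> real L1) set)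
             = abs_summing_ops (2 / real CARD('m)) ell1_scale L1_scale \<and>
          (\<forall>r. 0 < r \<and> r < 2 / real CARD('m) \<longrightarrow>
             (multilinear_ops ell1_scale L1_scale :: (real ell1 ^ 'm \<Rightarrow> real L1) set)
               \<noteq> abs_summing_ops r ell1_scale L1_scale)) \<and>
         ((multilinear_ops ell1_scale L1_scale :: (complex ell1 ^ 'm \<Rightarrow> complex L1) set)
             = abs_summing_ops (2 / real CARD('m)) ell1_scale L1_scale \<and>
          (\<forall>r. 0 < r \<and> r < 2 / real CARD('m) \<longrightarrow>
             (multilinear_ops ell1_scale L1_scale :: (complex ell1 ^ 'm \<Rightarrow> complex L1) set)
               \<noteq> abs_summing_ops r ell1_scale L1_scale))"
  by (intro conjI allI impI multilinear_ops_eq_abs_summing_ops multilinear_ops_neq_abs_summing_ops)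
     simp_all

end
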